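(* Let $G$ be a second-countable locally compact group and let $\beta:G\curvearrowright B$ be an action on a non-unital C*-algebra. (i) If $U\in\mathcal U(\mathcal M(B))$ is a unitary such that $U\beta_g(U)^*\in\mathcal U(\mathbf 1+B)$ for all $g\in G$, then $g\mapsto U\beta_g(U)^*$ is a norm-continuous map. (ii) Let $\mathsf u,\mathsf v:G\to\mathcal U(\mathcal M(B))$ be two strictly continuous $\beta$-cocycles, and suppose that $\mathsf u_g-\mathsf v_g\in B$ for all $g\in G$. Then the assignment $g\mapsto\mathsf u_g-\mathsf v_g$ defines a norm-continuous map on $G$. In particular, the last assumption (the norm-continuity assumption) in the definition of an $(\alpha,\beta)$-Cuntz pair is redundant.
   Context: An action is a point-norm continuous homomorphism $\beta:G\to\mathrm{Aut}(B)$, canonically extended to the multiplier algebra $\mathcal M(B)$. $\mathcal U(\cdot)$ is the unitary group, and $\mathcal U(\mathbf 1+B)=(\mathbf 1+B)\cap\mathcal U(\mathcal M(B))$ as $B$ is non-unital. A $\beta$-cocycle is a map $\mathsf u:G\to\mathcal U(\mathcal M(B))$ with $\mathsf u_{gh}=\mathsf u_g\beta_g(\mathsf u_h)$. For actions $\alpha:G\curvearrowright A$ and $\beta:G\curvearrowright B$ on separable C*-algebras, let $B^s=B\otimes\mathcal K$, $\beta^s=\beta\otimes\mathrm{id}_{\mathcal K}$, with $\mathcal K$ the compact operators on a separable infinite-dimensional Hilbert space. A cocycle representation $(\phi,\mathsf u):(A,\alpha)\to(\mathcal M(B^s),\beta^s)$ is a pair of a $*$-homomorphism $\phi:A\to\mathcal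 M(B^s)$ and a strictly continuous $\beta^s$-cocycle $\mathsf u:G\to\mathcal U(\mathcal M(B^s))$ with $\mathsf u_g\beta^s_g(\phi(a))\mathsf u_g^*=\phi(\alpha_g(a))$. An $(\alpha,\beta)$-Cuntz pair $(\phi^\pm,\mathsf u^\pm)$ consists of two cocycle representations $(\phi^i,\mathsf u^i):(A,\alpha)\to(\mathcal M(B^s),\beta^s)$, $i\in\{+,-\}$, such that: $\phi^+(a)-\phi^-(a)\in B^s$ for all $a\in A$; $\mathsf u^+_g-\mathsf u^-_g\in B^s$ for all $g\in G$; and the map $g\mapsto\mathsf u^+_g-\mathsf u^-_g$ is norm-continuous on $G$. *)

theory Defs
  imports "HOL-Analysis.Analysis"
begin

section \<open>C*-algebras and Hilbert spaces\<close>

class complex_normed_space = real_normed_vector +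
  fixes scaleC :: "complex \<Rightarrow> 'a \<Rightarrow> 'a"  (infixr "*\<^sub>C" 75)
  assumes scaleC_add_right: "c *\<^sub>C (x + y) = c *\<^sub>C x + c *\<^sub>C y"
    and scaleC_add_left: "(c + d) *\<^sub>C x = c *\<^sub>C x + d *\<^sub>C x"
    and scaleC_scaleC: "c *\<^sub>C d *\<^sub>C x = (c * d) *\<^sub>C x"
    and scaleC_of_real: "complex_of_real r *\<^sub>C x = r *\<^sub>R x"
    and norm_scaleC: "norm (c *\<^sub>C x) = cmod c * norm x"

text \<open>Not necessarily unital, not necessarily nonzero.\<close>

class cstar_algebra = complex_normed_space + real_normed_algebra + banach +
  fixes star :: "'a \<Rightarrow> 'a"
  assumes mult_scaleC_left: "(c *\<^sub>C x) * y = c *\<^sub>C (x * y)"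
    and mult_scaleC_right: "x * (c *\<^sub>C y) = c *\<^sub>C (x * y)"
    and star_add: "star (x + y) = star x + star y"
    and star_scaleC: "star (c *\<^sub>C x) = cnj c *\<^sub>C star x"
    and star_mult: "star (x * y) = star y * star x"
    and star_star: "star (star x) = x"
    and cstar_identity: "norm (star x * x) = (norm x)\<^sup>2"

definition has_unit :: "'a::cstar_algebra itself \<Rightarrow> bool" where
  "has_unit _ \<longleftrightarrow> (\<exists>e::'a. \<forall>x. e * x = x \<and> x * e = x)"

text \<open>The inner product is antilinear in the first argument. Positivity and definiteness are
  contained in the last axiom.\<close>

class complex_hilbert_space = complex_normed_space + banach +
  fixes cinner :: "'a \<Rightarrow> 'a \<Rightarrow> complex"
  assumes cinner_add_right: "cinner x (y + z) = cinner x y + cinner x z"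
    and cinner_scaleC_right: "cinner x (c *\<^sub>C y) = c * cinner x y"
    and cinner_commute: "cinner x y = cnj (cinner y x)"
    and cinner_self: "cinner x x = complex_of_real ((norm x)\<^sup>2)"

definition clinear :: "('a::complex_normed_space \<Rightarrow> 'b::complex_normed_space) \<Rightarrow> bool" where
  "clinear f \<longleftrightarrow> (\<forall>x y. f (x + y) = f x + f y) \<and> (\<forall>c x. f (c *\<^sub>C x) = c *\<^sub>C f x)"

definition star_hom :: "('a::cstar_algebra \<Rightarrow> 'b::cstar_algebra) \<Rightarrow> bool" where
  "star_hom f \<longleftrightarrow> clinear f \<and> (\<forall>x y. f (x * y) = f x * f y) \<and> (\<forall>x. f (star x) = star (f x))"

definition star_automorphism :: "('a::cstar_algebra \<Rightarrow> 'a) \<Rightarrow> bool" where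
  "star_automorphism f \<longleftrightarrow> star_hom f \<and> bij f"

lemma scaleC_zero_right [simp]: "c *\<^sub>C 0 = 0" for c :: complex
  using scaleC_add_right[of c 0 0] by simp

lemma scaleC_minus_right: "c *\<^sub>C (- x) = - (c *\<^sub>C x)"
  using scaleC_add_right[of c x "- x"] by (simp add: eq_neg_iff_add_eq_0 add.commute)

lemma scaleC_diff_right: "c *\<^sub>C (x - y) = c *\<^sub>C x - c *\<^sub>C y"
  using scaleC_add_right[of c x "- y"] by (simp add: scaleC_minus_right)

lemma bounded_linear_scaleC_right: "bounded_linear (\<lambda>x. c *\<^sub>C x)"
proof (rule bounded_linear_intro[where K = "cmod c"])
  show "c *\<^sub>C (r *\<^sub>R x) = r *\<^sub>R (c *\<^sub>C x)" for r x
    by (metis scaleC_of_real scaleC_scaleC mult.commute)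
qed (simp_all add: scaleC_add_right norm_scaleC mult.commute)

lemma star_zero [simp]: "star (0::'a::cstar_algebra) = 0"
  using star_add[of 0 0] by simp

lemma star_minus: "star (- x) = - star (x::'a::cstar_algebra)"
  using star_add[of x "- x"] by (simp add: eq_neg_iff_add_eq_0 add.commute)

lemma star_diff: "star (x - y) = star x - star (y::'a::cstar_algebra)"
  using star_add[of x "- y"] by (simp add: star_minus)

lemma star_scaleR: "star (r *\<^sub>R x) = r *\<^sub>R star (x::'a::cstar_algebra)"
  by (metis scaleC_of_real star_scaleC complex_cnj_complex_of_real)

lemma norm_star [simp]: "norm (star x) = norm (x::'a::cstar_algebra)"
proof -
  have *: "norm y \<le> norm (star y)" for y :: 'a
  proof -
    have "(norm y)\<^sup>2 \<le> norm (star y) * norm y"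
      by (metis cstar_identity norm_mult_ineq)
    then show ?thesis
      by (cases "norm y = 0") (auto simp: power2_eq_square)
  qed
  from *[of x] *[of "star x"] show ?thesis by (simp add: star_star)
qed

lemma bounded_linear_star: "bounded_linear (star :: 'a::cstar_algebra \<Rightarrow> 'a)"
  by (rule bounded_linear_intro[where K = 1]) (simp_all add: star_add star_scaleR)


section \<open>The multiplier algebra\<close>

text \<open>Double centralizers \<open>(L, R)\<close>, where \<open>L b\<close> plays the role of \<open>m b\<close> and \<open>R b\<close> that of \<open>b m\<close>.\<close>

definition double_centralizer ::
    "('b::cstar_algebra \<Rightarrow>\<^sub>L 'b) \<times> ('b \<Rightarrow>\<^sub>L 'b) \<Rightarrow> bool" where
  "double_centralizer m \<longleftrightarrow> (case m of (L, R) \<Rightarrow>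
     (\<forall>c x. blinfun_apply L (c *\<^sub>C x) = c *\<^sub>C blinfun_apply L x) \<and>
     (\<forall>c x. blinfun_apply R (c *\<^sub>C x) = c *\<^sub>C blinfun_apply R x) \<and>
     (\<forall>x y. blinfun_apply L (x * y) = blinfun_apply L x * y) \<and>
     (\<forall>x y. blinfun_apply R (x * y) = x * blinfun_apply R y) \<and>
     (\<forall>x y. x * blinfun_apply L y = blinfun_apply R x * y))"

typedef (overloaded) ('b::cstar_algebra) multiplier =
  "{m :: ('b \<Rightarrow>\<^sub>L 'b) \<times> ('b \<Rightarrow>\<^sub>L 'b). double_centralizer m}"
  by (rule exI[of _ 0]) (simp add: double_centralizer_def zero_prod_def)

setup_lifting type_definition_multiplier

definition lmult :: "'b::cstar_algebra multiplier \<Rightarrow> ('b \<Rightarrow>\<^sub>L 'b)" where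
  "lmult m = fst (Rep_multiplier m)"
definition rmult :: "'b::cstar_algebra multiplier \<Rightarrow> ('b \<Rightarrow>\<^sub>L 'b)" where
  "rmult m = snd (Rep_multiplier m)"

lemma lmult_transfer [transfer_rule]: "rel_fun cr_multiplier (=) fst lmult"
  and rmult_transfer [transfer_rule]: "rel_fun cr_multiplier (=) snd rmult"
  by (auto simp: rel_fun_def cr_multiplier_def lmult_def rmult_def)

lemma cstar_faithful_left: "(\<And>a. a * x = 0) \<Longrightarrow> x = (0::'b::cstar_algebra)"
  by (metis cstar_identity norm_eq_zero norm_zero power_eq_0_iff)

lemma cstar_faithful_right: "(\<And>a. x * a = 0) \<Longrightarrow> x = (0::'b::cstar_algebra)"
  by (metis cstar_faithful_left star_mult star_star star_zero)

lemma lmult_scaleC: "lmult m (c *\<^sub>C x) = c *\<^sub>C lmult m x"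
  and rmult_scaleC: "rmult m (c *\<^sub>C x) = c *\<^sub>C rmult m x"
  and lmult_mult: "lmult m (x * y) = lmult m x * y"
  and rmult_mult: "rmult m (x * y) = x * rmult m y"
  and mult_lmult: "x * lmult m y = rmult m x * y"
  using Rep_multiplier[of m]
  by (auto simp: double_centralizer_def lmult_def rmult_def case_prod_beta)

lemma multiplier_eqI:
  assumes "\<And>b. lmult m b = lmult n b" shows "m = n"
proof -
  have "rmult m a - rmult n a = 0" for a
    by (rule cstar_faithful_right) (simp add: left_diff_distrib assms flip: mult_lmult)
  then have "lmult m = lmult n" "rmult m = rmult n"
    using assms by (auto intro: blinfun_eqI)
  then show ?thesis
    by (simp add: lmult_def rmult_def Rep_multiplier_inject[symmetric] prod_eq_iff)
qed

instantiation multiplier :: (cstar_algebra) real_vector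
begin
lift_definition zero_multiplier :: "'a multiplier" is 0
  by (simp add: double_centralizer_def zero_prod_def)
lift_definition plus_multiplier :: "'a multiplier \<Rightarrow> 'a multiplier \<Rightarrow> 'a multiplier" is "\<lambda>(L, R) (L', R'). (L + L', R + R')"
  by (auto simp: double_centralizer_def blinfun.add_left scaleC_add_right distrib_left distrib_right)
lift_definition minus_multiplier :: "'a multiplier \<Rightarrow> 'a multiplier \<Rightarrow> 'a multiplier" is "\<lambda>(L, R) (L', R'). (L - L', R - R')"
  by (auto simp: double_centralizer_def blinfun.diff_left scaleC_diff_right left_diff_distrib right_diff_distrib)
lift_definition uminus_multiplier :: "'a multiplier \<Rightarrow> 'a multiplier" is "\<lambda>(L, R). (- L, - R)"
  by (auto simp: double_centralizer_def blinfun.minus_left scaleC_minus_right)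
lift_definition scaleR_multiplier :: "real \<Rightarrow> 'a multiplier \<Rightarrow> 'a multiplier" is "\<lambda>r (L, R). (r *\<^sub>R L, r *\<^sub>R R)"
  by (auto simp: double_centralizer_def blinfun.scaleR_left
      linear_simps(5)[OF bounded_linear_scaleC_right])
lemma lmult_simps [simp]:
  "lmult 0 = 0" "lmult (m + n) = lmult m + lmult n" "lmult (m - n) = lmult m - lmult n"
  "lmult (- m) = - lmult m" "lmult (r *\<^sub>R m) = r *\<^sub>R lmult m"
  by (simp_all add: lmult_def plus_multiplier.rep_eq minus_multiplier.rep_eq uminus_multiplier.rep_eq
      zero_multiplier.rep_eq scaleR_multiplier.rep_eq case_prod_beta)

lemma rmult_simps [simp]:
  "rmult 0 = 0" "rmult (m + n) = rmult m + rmult n" "rmult (m - n) = rmult m - rmult n"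
  "rmult (- m) = - rmult m" "rmult (r *\<^sub>R m) = r *\<^sub>R rmult m"
  by (simp_all add: rmult_def plus_multiplier.rep_eq minus_multiplier.rep_eq uminus_multiplier.rep_eq
      zero_multiplier.rep_eq scaleR_multiplier.rep_eq case_prod_beta)

instance
  by standard (auto intro!: multiplier_eqI simp: blinfun.add_left blinfun.scaleR_left
      scaleR_add_right scaleR_add_left)
end

instantiation multiplier :: (cstar_algebra) real_normed_vector
begin
definition norm_multiplier :: "'a multiplier \<Rightarrow> real" where
  "norm_multiplier m = norm (lmult m)"
definition sgn_multiplier :: "'a multiplier \<Rightarrow> 'a multiplier" where
  "sgn_multiplier m = m /\<^sub>R norm m"
definition dist_multiplier :: "'a multiplier \<Rightarrow> 'a multiplier \<Rightarrow> real" where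
  "dist_multiplier m n = norm (m - n)"
definition uniformity_multiplier :: "('a multiplier \<times> 'a multiplier) filter" where
  "uniformity_multiplier = (INF e\<in>{0 <..}. principal {(x, y). dist x y < e})"
definition open_multiplier :: "'a multiplier set \<Rightarrow> bool" where
  "open_multiplier S = (\<forall>x\<in>S. \<forall>\<^sub>F (x', y) in uniformity. x' = x \<longrightarrow> y \<in> S)"
instance
proof
  fix m n :: "'a multiplier" and r :: real
  show "norm m = 0 \<longleftrightarrow> m = 0"
    by (auto simp: norm_multiplier_def intro!: multiplier_eqI)
  show "norm (m + n) \<le> norm m + norm n"
    by (simp add: norm_multiplier_def norm_triangle_ineq)
  show "norm (r *\<^sub>R m) = \<bar>r\<bar> * norm m"
    by (simp add: norm_multiplier_def)
qed (simp_all add: sgn_multiplier_def dist_multiplier_def uniformity_multiplier_def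
      open_multiplier_def)
end

lemma norm_rmult: "norm (rmult m) = norm (m :: 'a::cstar_algebra multiplier)"
proof (rule antisym)
  show "norm (rmult m) \<le> norm m"
  proof (rule norm_blinfun_bound)
    fix a
    have "(norm (rmult m a))\<^sup>2 = norm (rmult m a * star (rmult m a))"
      using cstar_identity[of "star (rmult m a)"] by (simp add: star_star)
    also have "\<dots> = norm (a * lmult m (star (rmult m a)))"
      by (simp add: mult_lmult)
    also have "\<dots> \<le> norm a * norm (lmult m (star (rmult m a)))"
      by (rule norm_mult_ineq)
    also have "\<dots> \<le> norm a * (norm m * norm (rmult m a))"
      using norm_blinfun[of "lmult m" "star (rmult m a)"]
      by (intro mult_left_mono) (simp_all add: norm_multiplier_def)
    finally have "norm (rmult m a) * norm (rmult m a) \<le> (norm m * norm a) * norm (rmult m a)"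
      by (simp add: power2_eq_square mult_ac)
    then show "norm (rmult m a) \<le> norm m * norm a"
      by (cases "norm (rmult m a) = 0") auto
  qed simp
  show "norm m \<le> norm (rmult m)"
    unfolding norm_multiplier_def
  proof (rule norm_blinfun_bound)
    fix a
    have "(norm (lmult m a))\<^sup>2 = norm (star (lmult m a) * lmult m a)"
      by (simp add: cstar_identity)
    also have "\<dots> = norm (rmult m (star (lmult m a)) * a)"
      by (simp add: mult_lmult)
    also have "\<dots> \<le> norm (rmult m (star (lmult m a))) * norm a"
      by (rule norm_mult_ineq)
    also have "\<dots> \<le> norm (rmult m) * norm (lmult m a) * norm a"
      using norm_blinfun[of "rmult m" "star (lmult m a)"]
      by (intro mult_right_mono) simp_all
    finally have "norm (lmult m a) * norm (lmult m a) \<le> (norm (rmult m) * norm a) * norm (lmult m a)"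
      by (simp add: power2_eq_square mult_ac)
    then show "norm (lmult m a) \<le> norm (rmult m) * norm a"
      by (cases "norm (lmult m a) = 0") auto
  qed simp
qed

instantiation multiplier :: (cstar_algebra) real_normed_algebra
begin
lift_definition times_multiplier :: "'a multiplier \<Rightarrow> 'a multiplier \<Rightarrow> 'a multiplier"
  is "\<lambda>(L, R) (L', R'). (L o\<^sub>L L', R' o\<^sub>L R)"
  by (auto simp: double_centralizer_def)
lemma lmult_times [simp]: "lmult (m * n) = lmult m o\<^sub>L lmult (n::'a multiplier)"
  by transfer auto
lemma rmult_times [simp]: "rmult (m * n) = rmult n o\<^sub>L rmult (m::'a multiplier)"
  by transfer auto
instance
proof
  fix m n :: "'a multiplier"
  show "norm (m * n) \<le> norm m * norm n"
    by (simp add: norm_multiplier_def norm_blinfun_compose)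
qed (auto intro!: multiplier_eqI simp: blinfun.add_left blinfun.add_right
      blinfun.scaleR_left blinfun.scaleR_right)
end

instantiation multiplier :: (cstar_algebra) monoid_mult
begin
lift_definition one_multiplier :: "'a multiplier" is "(id_blinfun, id_blinfun)"
  by (simp add: double_centralizer_def)
lemma lmult_one [simp]: "lmult (1::'a multiplier) = id_blinfun"
  by transfer simp
lemma rmult_one [simp]: "rmult (1::'a multiplier) = id_blinfun"
  by transfer simp
instance by standard (auto intro!: multiplier_eqI)
end

instantiation blinfun :: (real_normed_vector, complex_normed_space) complex_normed_space
begin
lift_definition scaleC_blinfun :: "complex \<Rightarrow> ('a \<Rightarrow>\<^sub>L 'b) \<Rightarrow> ('a \<Rightarrow>\<^sub>L 'b)" is "\<lambda>c f x. c *\<^sub>C f x"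
  by (rule bounded_linear_compose[OF bounded_linear_scaleC_right])
instance
proof
  fix c d :: complex and r :: real and S T :: "'a \<Rightarrow>\<^sub>L 'b"
  show "c *\<^sub>C (S + T) = c *\<^sub>C S + c *\<^sub>C T"
    by (rule blinfun_eqI) (simp add: scaleC_blinfun.rep_eq blinfun.add_left scaleC_add_right)
  show "(c + d) *\<^sub>C T = c *\<^sub>C T + d *\<^sub>C T"
    by (rule blinfun_eqI) (simp add: scaleC_blinfun.rep_eq blinfun.add_left scaleC_add_left)
  show "c *\<^sub>C d *\<^sub>C T = (c * d) *\<^sub>C T"
    by (rule blinfun_eqI) (simp add: scaleC_blinfun.rep_eq scaleC_scaleC)
  show "complex_of_real r *\<^sub>C T = r *\<^sub>R T"
    by (rule blinfun_eqI) (simp add: scaleC_blinfun.rep_eq blinfun.scaleR_left scaleC_of_real)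
  have le: "norm (e *\<^sub>C U) \<le> cmod e * norm U" for e and U :: "'a \<Rightarrow>\<^sub>L 'b"
  proof (rule norm_blinfun_bound)
    fix x
    have "norm ((e *\<^sub>C U) x) = cmod e * norm (U x)"
      by (simp add: scaleC_blinfun.rep_eq norm_scaleC)
    also have "\<dots> \<le> cmod e * (norm U * norm x)"
      by (intro mult_left_mono norm_blinfun) auto
    finally show "norm ((e *\<^sub>C U) x) \<le> cmod e * norm U * norm x" by (simp add: mult_ac)
  qed simp
  show "norm (c *\<^sub>C T) = cmod c * norm T"
  proof (cases "c = 0")
    case True
    then show ?thesis using le[of c T] by simp
  next
    case False
    have "(1::complex) *\<^sub>C T = T"
      using scaleC_of_real[of 1] by (intro blinfun_eqI) (simp add: scaleC_blinfun.rep_eq)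
    moreover have "inverse c *\<^sub>C c *\<^sub>C T = (inverse c * c) *\<^sub>C T"
      by (intro blinfun_eqI) (simp add: scaleC_blinfun.rep_eq scaleC_scaleC)
    ultimately have "norm T \<le> cmod (inverse c) * norm (c *\<^sub>C T)"
      using le[of "inverse c" "c *\<^sub>C T"] False by simp
    then have "cmod c * norm T \<le> norm (c *\<^sub>C T)"
      using False by (simp add: norm_inverse norm_divide field_simps)
    then show ?thesis using le[of c T] by simp
  qed
qed
end

instantiation multiplier :: (cstar_algebra) complex_normed_space
begin
lift_definition scaleC_multiplier :: "complex \<Rightarrow> 'a multiplier \<Rightarrow> 'a multiplier"
  is "\<lambda>c (L, R). (c *\<^sub>C L, c *\<^sub>C R)"
  by (auto simp: double_centralizer_def scaleC_blinfun.rep_eq scaleC_scaleC mult.commute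
      mult_scaleC_left mult_scaleC_right)
lemma lmult_scaleC_multiplier [simp]: "lmult (c *\<^sub>C m) = c *\<^sub>C lmult (m::'a multiplier)"
  by transfer auto
lemma rmult_scaleC_multiplier [simp]: "rmult (c *\<^sub>C m) = c *\<^sub>C rmult (m::'a multiplier)"
  by transfer auto
instance
proof
  fix c d :: complex and r :: real and m n :: "'a multiplier"
  show "c *\<^sub>C (m + n) = c *\<^sub>C m + c *\<^sub>C n"
    by (rule multiplier_eqI) (simp add: scaleC_add_right)
  show "(c + d) *\<^sub>C m = c *\<^sub>C m + d *\<^sub>C m"
    by (rule multiplier_eqI) (simp add: scaleC_add_left)
  show "c *\<^sub>C d *\<^sub>C m = (c * d) *\<^sub>C m"
    by (rule multiplier_eqI) (simp add: scaleC_scaleC)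
  show "complex_of_real r *\<^sub>C m = r *\<^sub>R m"
    by (rule multiplier_eqI) (simp add: scaleC_of_real)
  show "norm (c *\<^sub>C m) = cmod c * norm m"
    unfolding norm_multiplier_def lmult_scaleC_multiplier by (rule norm_scaleC)
qed
end

lift_definition star_conj :: "('a::cstar_algebra \<Rightarrow>\<^sub>L 'a) \<Rightarrow> ('a \<Rightarrow>\<^sub>L 'a)"
  is "\<lambda>T a. star (T (star a))"
  by (rule bounded_linear_compose[OF bounded_linear_star
        bounded_linear_compose[OF _ bounded_linear_star]])

instance multiplier :: (cstar_algebra) banach
proof
  fix X :: "nat \<Rightarrow> 'a multiplier"
  assume X: "Cauchy X"
  have "Cauchy (\<lambda>n. lmult (X n))" "Cauchy (\<lambda>n. rmult (X n))"
    using X unfolding Cauchy_def dist_norm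
    by (simp_all flip: lmult_simps rmult_simps add: norm_rmult)
      (simp add: norm_multiplier_def)
  then obtain L R where L: "(\<lambda>n. lmult (X n)) \<longlonglongrightarrow> L" and R: "(\<lambda>n. rmult (X n)) \<longlonglongrightarrow> R"
    by (meson Cauchy_convergent convergent_def)
  have L': "(\<lambda>n. lmult (X n) x) \<longlonglongrightarrow> L x" and R': "(\<lambda>n. rmult (X n) x) \<longlonglongrightarrow> R x" for x
    using L R by (auto intro: tendsto_intros)
  have "double_centralizer (L, R)"
    unfolding double_centralizer_def prod.case
  proof (intro conjI allI)
    fix c and x y :: 'a
    show "L (c *\<^sub>C x) = c *\<^sub>C L x"
      using L'[of "c *\<^sub>C x"] bounded_linear.tendsto[OF bounded_linear_scaleC_right L'[of x]]
      by (auto simp: lmult_scaleC intro: LIMSEQ_unique)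
    show "R (c *\<^sub>C x) = c *\<^sub>C R x"
      using R'[of "c *\<^sub>C x"] bounded_linear.tendsto[OF bounded_linear_scaleC_right R'[of x]]
      by (auto simp: rmult_scaleC intro: LIMSEQ_unique)
    show "L (x * y) = L x * y"
      using L'[of "x * y"] tendsto_mult_right[OF L'[of x], of y]
      by (auto simp: lmult_mult intro: LIMSEQ_unique)
    show "R (x * y) = x * R y"
      using R'[of "x * y"] tendsto_mult_left[OF R'[of y], of x]
      by (auto simp: rmult_mult intro: LIMSEQ_unique)
    show "x * L y = R x * y"
      using tendsto_mult_left[OF L'[of y], of x] tendsto_mult_right[OF R'[of x], of y]
      by (auto simp: mult_lmult intro: LIMSEQ_unique)
  qed
  then obtain m where m: "lmult m = L"
    by (metis Abs_multiplier_inverse fst_conv lmult_def mem_Collect_eq)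
  have "X \<longlonglongrightarrow> m"
    using L unfolding m[symmetric] LIMSEQ_iff norm_multiplier_def by simp
  then show "convergent X" by (auto simp: convergent_def)
qed

instantiation multiplier :: (cstar_algebra) cstar_algebra
begin
lift_definition star_multiplier :: "'a multiplier \<Rightarrow> 'a multiplier"
  is "\<lambda>(L, R). (star_conj R, star_conj L)"
  by (auto simp: double_centralizer_def star_conj.rep_eq star_scaleC star_mult star_star)
    (metis star_mult star_star)
lemma lmult_star [simp]: "lmult (star m) = star_conj (rmult (m::'a multiplier))"
  by transfer auto
lemma rmult_star [simp]: "rmult (star m) = star_conj (lmult (m::'a multiplier))"
  by transfer auto
instance
proof
  fix m n :: "'a multiplier" and c :: complex
  show "(c *\<^sub>C m) * n = c *\<^sub>C (m * n)" "m * (c *\<^sub>C n) = c *\<^sub>C (m * n)"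
    by (auto intro!: multiplier_eqI simp: scaleC_blinfun.rep_eq lmult_scaleC)
  show "star (m + n) = star m + star n"
    by (auto intro!: multiplier_eqI simp: star_conj.rep_eq blinfun.add_left star_add)
  show "star (c *\<^sub>C m) = cnj c *\<^sub>C star m"
    by (auto intro!: multiplier_eqI simp: star_conj.rep_eq scaleC_blinfun.rep_eq star_scaleC)
  show "star (m * n) = star n * star m"
    by (auto intro!: multiplier_eqI simp: star_conj.rep_eq star_star)
  show "star (star m) = m"
    by (auto intro!: multiplier_eqI simp: star_conj.rep_eq star_star)
  have le: "(norm m)\<^sup>2 \<le> norm (star m * m)"
  proof -
    have "norm (lmult m) \<le> sqrt (norm (star m * m))"
    proof (rule norm_blinfun_bound)
      fix b
      have "(norm (lmult m b))\<^sup>2 = norm (star (lmult m b) * lmult m b)"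
        by (simp add: cstar_identity)
      also have "star (lmult m b) * lmult m b = rmult (star m) (star b) * lmult m b"
        by (simp add: star_conj.rep_eq star_star)
      also have "\<dots> = star b * lmult (star m * m) b"
        by (simp flip: mult_lmult del: lmult_star rmult_star)
      also have "norm \<dots> \<le> norm (star b) * norm (lmult (star m * m) b)"
        by (rule norm_mult_ineq)
      also have "\<dots> \<le> norm b * (norm (star m * m) * norm b)"
        using norm_blinfun[of "lmult (star m * m)" b] unfolding norm_multiplier_def
        by (intro mult_mono) simp_all
      finally have "(norm (lmult m b))\<^sup>2 \<le> norm (star m * m) * (norm b)\<^sup>2"
        by (simp add: power2_eq_square mult_ac)
      from real_le_rsqrt[OF this]
      show "norm (lmult m b) \<le> sqrt (norm (star m * m)) * norm b"
        by (simp add: real_sqrt_mult)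
    qed simp
    then have "norm m \<le> sqrt (norm (star m * m))"
      by (simp only: norm_multiplier_def[of m])
    from power_mono[OF this norm_ge_zero, of 2] show ?thesis
      by simp
  qed
  have sle: "norm (star k) \<le> norm k" for k :: "'a multiplier"
    unfolding norm_multiplier_def[of "star k"]
  proof (rule norm_blinfun_bound)
    show "norm (lmult (star k) b) \<le> norm k * norm b" for b
      using norm_blinfun[of "rmult k" "star b"] by (simp add: star_conj.rep_eq norm_rmult)
  qed simp
  have "norm (star m * m) \<le> norm (star m) * norm m"
    by (rule norm_mult_ineq)
  also have "\<dots> \<le> norm m * norm m"
    using sle by (simp add: mult_right_mono)
  finally show "norm (star m * m) = (norm m)\<^sup>2"
    using le by (simp add: power2_eq_square)
qed
end

lift_definition mult_embed :: "'b::cstar_algebra \<Rightarrow> 'b multiplier"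
  is "\<lambda>b. (Blinfun (\<lambda>x. b * x), Blinfun (\<lambda>x. x * b))"
  by (simp add: double_centralizer_def bounded_linear_Blinfun_apply bounded_linear_mult_left
      bounded_linear_mult_right mult_scaleC_left mult_scaleC_right mult.assoc)

lemma lmult_embed [simp]: "lmult (mult_embed b) x = b * x"
  and rmult_embed [simp]: "rmult (mult_embed b) x = x * b"
  by (simp_all add: lmult_def rmult_def mult_embed.rep_eq bounded_linear_Blinfun_apply
      bounded_linear_mult_left bounded_linear_mult_right)

lemma mult_embed_lmult: "m * mult_embed b = mult_embed (lmult m b)"
  and mult_embed_rmult: "mult_embed b * m = mult_embed (rmult m b)"
  by (auto intro!: multiplier_eqI simp: lmult_mult mult_lmult)

lemma norm_mult_embed: "norm (mult_embed b) = norm b"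
proof (rule antisym)
  show "norm (mult_embed b) \<le> norm b"
    unfolding norm_multiplier_def
    by (rule norm_blinfun_bound) (simp_all add: norm_mult_ineq)
  have "norm b * norm b = norm (lmult (mult_embed b) (star b))"
    using cstar_identity[of "star b"] by (simp add: star_star power2_eq_square)
  also have "\<dots> \<le> norm (mult_embed b) * norm b"
    using norm_blinfun[of "lmult (mult_embed b)" "star b"] by (simp add: norm_multiplier_def)
  finally show "norm b \<le> norm (mult_embed b)"
    by (cases "b = 0") auto
qed

lemma star_hom_mult_embed: "star_hom mult_embed"
  unfolding star_hom_def clinear_def
  by (auto intro!: multiplier_eqI simp: blinfun.add_left distrib_right mult.assoc star_mult star_star
      scaleC_blinfun.rep_eq mult_scaleC_left star_conj.rep_eq)

definition unitary :: "'b::cstar_algebra multiplier \<Rightarrow> bool" where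
  "unitary u \<longleftrightarrow> star u * u = 1 \<and> u * star u = 1"

definition unitaries_one_plus :: "'b::cstar_algebra multiplier set" where
  "unitaries_one_plus = {u. unitary u \<and> (\<exists>b. u = 1 + mult_embed b)}"

text \<open>The extension of a *-automorphism \<open>f\<close> of \<open>B\<close> to the multiplier algebra:
  \<open>f(m) b = f(m f\<^sup>-\<^sup>1(b))\<close> and \<open>b f(m) = f(f\<^sup>-\<^sup>1(b) m)\<close>. The maps on the right are bounded
  because *-automorphisms are isometric; for other \<open>f\<close> the value is meaningless.\<close>

definition mult_extend :: "('b::cstar_algebra \<Rightarrow> 'b) \<Rightarrow> 'b multiplier \<Rightarrow> 'b multiplier" where
  "mult_extend f m = Abs_multiplier
     (Blinfun (\<lambda>b. f (lmult m (inv f b))), Blinfun (\<lambda>b. f (rmult m (inv f b))))"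

lemma mult_extend:
  assumes f: "star_automorphism f" and bdd: "bounded_linear f" "bounded_linear (inv f)"
  shows "lmult (mult_extend f m) b = f (lmult m (inv f b))" (is ?L)
    and "rmult (mult_extend f m) b = f (rmult m (inv f b))" (is ?R)
    and "mult_extend f (mult_embed c) = mult_embed (f c)" (is ?E)
proof -
  have bij: "bij f" and add: "\<And>x y. f (x + y) = f x + f y" and mult: "\<And>x y. f (x * y) = f x * f y"
    and sc: "\<And>c x. f (c *\<^sub>C x) = c *\<^sub>C f x"
    using f by (auto simp: star_automorphism_def star_hom_def clinear_def)
  have ff [simp]: "f (inv f x) = x" "inv f (f x) = x" for x
    using bij by (auto simp: bij_def surj_f_inv_f)
  have imult: "inv f (x * y) = inv f x * inv f y" for x y
    by (metis ff mult)
  have isc: "inv f (c *\<^sub>C x) = c *\<^sub>C inv f x" for c x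
    by (metis ff sc)
  have bl: "bounded_linear (\<lambda>b. f (blinfun_apply T (inv f b)))" for T
    by (intro bounded_linear_compose[OF bdd(1)] bounded_linear_compose[OF blinfun.bounded_linear_right]
        bdd(2))
  have "double_centralizer (Blinfun (\<lambda>b. f (lmult n (inv f b))), Blinfun (\<lambda>b. f (rmult n (inv f b))))"
    for n
    unfolding double_centralizer_def prod.case bounded_linear_Blinfun_apply[OF bl]
  proof (intro conjI allI)
    fix x y
    have "x * f (lmult n (inv f y)) = f (inv f x * lmult n (inv f y))" by (simp add: mult)
    also have "\<dots> = f (rmult n (inv f x)) * y" by (simp add: mult_lmult mult)
    finally show "x * f (lmult n (inv f y)) = f (rmult n (inv f x)) * y" .
  qed (simp_all add: imult isc lmult_scaleC rmult_scaleC lmult_mult rmult_mult mult sc)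
  then have rep: "Rep_multiplier (mult_extend f n) =
      (Blinfun (\<lambda>b. f (lmult n (inv f b))), Blinfun (\<lambda>b. f (rmult n (inv f b))))" for n
    unfolding mult_extend_def by (simp add: Abs_multiplier_inverse)
  have l: "lmult (mult_extend f n) b = f (lmult n (inv f b))" for n b
    by (simp add: lmult_def rep bounded_linear_Blinfun_apply[OF bl, unfolded lmult_def])
  then show ?L .
  show ?R
    by (simp add: rmult_def rep bounded_linear_Blinfun_apply[OF bl, unfolded rmult_def])
  show ?E
    by (rule multiplier_eqI) (simp add: l mult)
qed

definition strictly_continuous ::
    "('g::topological_space \<Rightarrow> 'b::cstar_algebra multiplier) \<Rightarrow> bool" where
  "strictly_continuous u \<longleftrightarrow>
     (\<forall>b. continuous_on UNIV (\<lambda>g. lmult (u g) b) \<and> continuous_on UNIV (\<lambda>g. rmult (u g) b))"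


section \<open>Actions and cocycles\<close>

text \<open>Groups are written additively, following \<^class>\<open>topological_group_add\<close>, which does not
  assume commutativity.\<close>

definition is_action :: "('g::topological_group_add \<Rightarrow> 'b::cstar_algebra \<Rightarrow> 'b) \<Rightarrow> bool" where
  "is_action \<beta> \<longleftrightarrow>
     (\<forall>g. star_automorphism (\<beta> g)) \<and>
     (\<forall>g h. \<beta> (g + h) = \<beta> g \<circ> \<beta> h) \<and>
     (\<forall>b. continuous_on UNIV (\<lambda>g. \<beta> g b))"

definition is_cocycle ::
    "('g::topological_group_add \<Rightarrow> 'b::cstar_algebra \<Rightarrow> 'b) \<Rightarrow> ('g \<Rightarrow> 'b multiplier) \<Rightarrow> bool" where
  "is_cocycle \<beta> u \<longleftrightarrow>
     (\<forall>g. unitary (u g)) \<and> (\<forall>g h. u (g + h) = u g * mult_extend (\<beta> g) (u h))"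


section \<open>Stabilization\<close>

definition separable_infinite_dimensional :: "'h::complex_hilbert_space itself \<Rightarrow> bool" where
  "separable_infinite_dimensional _ \<longleftrightarrow>
     separable_space (euclidean :: 'h topology) \<and> \<not> (\<exists>F::'h set. finite F \<and> span F = UNIV)"

definition compact_operators :: "('h::complex_hilbert_space \<Rightarrow>\<^sub>L 'h) set" where
  "compact_operators =
     {T. clinear (blinfun_apply T) \<and> compact (closure (blinfun_apply T ` cball 0 1))}"

definition is_adjoint ::
    "('h::complex_hilbert_space \<Rightarrow>\<^sub>L 'h) \<Rightarrow> ('h \<Rightarrow>\<^sub>L 'h) \<Rightarrow> bool" where
  "is_adjoint S T \<longleftrightarrow> (\<forall>x y. cinner (blinfun_apply S x) y = cinner x (blinfun_apply T y))"

definition cindependent :: "'a::complex_normed_space set \<Rightarrow> bool" where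
  "cindependent F \<longleftrightarrow> (\<forall>c. (\<Sum>x\<in>F. c x *\<^sub>C x) = 0 \<longrightarrow> (\<forall>x\<in>F. c x = 0))"

text \<open>\<open>stabilization t\<close> says that the C*-algebra \<open>'s\<close>, with elementary tensors \<open>t b k\<close>, is
  \<open>B \<otimes> \<K>\<close> for \<open>\<K> = \<K>(H)\<close>: the map \<open>t\<close> (only its restriction to \<open>\<K>\<close> matters) identifies the
  algebraic tensor product, as a *-algebra, with a dense subalgebra of \<open>'s\<close>. Since \<open>\<K>\<close> is
  nuclear there is only one C*-norm on the algebraic tensor product, so this determines \<open>'s\<close> up to
  isomorphism. The fifth clause is injectivity on the algebraic tensor product. The real span in
  the last clause is already a complex subspace.\<close>

definition stabilization ::
    "('b::cstar_algebra \<Rightarrow> ('h::complex_hilbert_space \<Rightarrow>\<^sub>L 'h) \<Rightarrow> 's::cstar_algebra) \<Rightarrow> bool" where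
  "stabilization t \<longleftrightarrow>
     (\<forall>k\<in>compact_operators. clinear (\<lambda>b. t b k)) \<and>
     (\<forall>b. \<forall>k\<in>compact_operators. \<forall>l\<in>compact_operators. \<forall>c.
        t b (k + l) = t b k + t b l \<and> t b (c *\<^sub>C k) = c *\<^sub>C t b k) \<and>
     (\<forall>a b. \<forall>k\<in>compact_operators. \<forall>l\<in>compact_operators. t a k * t b l = t (a * b) (k o\<^sub>L l)) \<and>
     (\<forall>b. \<forall>k\<in>compact_operators. \<forall>l\<in>compact_operators.
        is_adjoint k l \<longrightarrow> star (t b k) = t (star b) l) \<and>
     (\<forall>F \<subseteq> compact_operators. \<forall>b. finite F \<and> cindependent F \<and> (\<Sum>k\<in>F. t (b k) k) = 0 \<longrightarrow>
        (\<forall>k\<in>F. b k = 0)) \<and>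
     closure (span {t b k |b k. k \<in> compact_operators}) = UNIV"

text \<open>\<open>\<beta>s\<close> is the action \<open>\<beta> \<otimes> id\<close> on \<open>B \<otimes> \<K>\<close>; by density it is determined by its values on
  elementary tensors.\<close>

definition stabilized_action ::
    "('b::cstar_algebra \<Rightarrow> ('h::complex_hilbert_space \<Rightarrow>\<^sub>L 'h) \<Rightarrow> 's::cstar_algebra) \<Rightarrow>
     ('g::topological_group_add \<Rightarrow> 'b \<Rightarrow> 'b) \<Rightarrow> ('g \<Rightarrow> 's \<Rightarrow> 's) \<Rightarrow> bool" where
  "stabilized_action t \<beta> \<beta>s \<longleftrightarrow>
     is_action \<beta>s \<and> (\<forall>g b. \<forall>k\<in>compact_operators. \<beta>s g (t b k) = t (\<beta> g b) k)"


section \<open>Cuntz pairs\<close>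

definition cocycle_representation ::
    "('g::topological_group_add \<Rightarrow> 'a::cstar_algebra \<Rightarrow> 'a) \<Rightarrow> ('g \<Rightarrow> 's::cstar_algebra \<Rightarrow> 's) \<Rightarrow>
     ('a \<Rightarrow> 's multiplier) \<Rightarrow> ('g \<Rightarrow> 's multiplier) \<Rightarrow> bool" where
  "cocycle_representation \<alpha> \<beta>s \<phi> u \<longleftrightarrow>
     star_hom \<phi> \<and> is_cocycle \<beta>s u \<and> strictly_continuous u \<and>
     (\<forall>g a. u g * mult_extend (\<beta>s g) (\<phi> a) * star (u g) = \<phi> (\<alpha> g a))"

definition cuntz_pair ::
    "('g::topological_group_add \<Rightarrow> 'a::cstar_algebra \<Rightarrow> 'a) \<Rightarrow> ('g \<Rightarrow> 's::cstar_algebra \<Rightarrow> 's) \<Rightarrow>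
     ('a \<Rightarrow> 's multiplier) \<Rightarrow> ('g \<Rightarrow> 's multiplier) \<Rightarrow>
     ('a \<Rightarrow> 's multiplier) \<Rightarrow> ('g \<Rightarrow> 's multiplier) \<Rightarrow> bool" where
  "cuntz_pair \<alpha> \<beta>s \<phi>p up \<phi>m um \<longleftrightarrow>
     cocycle_representation \<alpha> \<beta>s \<phi>p up \<and> cocycle_representation \<alpha> \<beta>s \<phi>m um \<and>
     (\<forall>a. \<phi>p a - \<phi>m a \<in> range mult_embed) \<and>
     (\<forall>g. up g - um g \<in> range mult_embed) \<and>
     continuous_on UNIV (\<lambda>g. up g - um g)"

end

theory Submission
  imports Defs
begin

text \<open>
  Everything is reduced to one statement about a map \<open>f\<close> from the group to \<open>B\<close>. For cocycles \<open>u\<close> and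
  \<open>v\<close> with \<open>u\<^sub>g - v\<^sub>g \<in> B\<close>, put \<open>f\<^sub>g = u\<^sub>g v\<^sub>g\<^sup>* - 1 \<in> B\<close>. The cocycle identities give
  \<open>f\<^sub>g\<^sub>h - f\<^sub>g = u\<^sub>g \<beta>\<^sub>g(f\<^sub>h) v\<^sub>g\<^sup>*\<close>, so the size of \<open>f\<^sub>g\<^sub>h - f\<^sub>g\<close> depends only on \<open>h\<close>: a
  discontinuity anywhere is one of the same size everywhere. If there were one, a gliding hump would
  produce points \<open>h\<^sub>0, h\<^sub>1, h\<^sub>2, \<dots>\<close> in a compact set whose increments \<open>x\<^sub>k = f(h\<^sub>k\<^sub>+\<^sub>1) - f(h\<^sub>k)\<close> have
  norm at least \<open>\<epsilon>\<close> but are almost orthogonal to each other. At a cluster point \<open>l\<close> the element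
  \<open>a = f(l) - f(h\<^sub>0)\<close> behaves like the sum of all \<open>x\<^sub>k\<close>, so that \<open>x\<^sub>k\<^sup>* a\<close> is about \<open>x\<^sub>k\<^sup>* x\<^sub>k\<close> and stays
  large; but \<open>x\<^sub>k\<close> tends to zero strictly along a subsequence and \<open>a\<close> lies in \<open>B\<close>, so \<open>x\<^sub>k\<^sup>* a\<close> tends
  to zero in norm. This is \<open>homogeneous_strictly_continuous_imp_continuous\<close>; the passage from it
  to \<open>u\<^sub>g - v\<^sub>g = f\<^sub>g v\<^sub>g\<close> is \<open>cocycle_diff_norm_continuous\<close>. It settles Cuntz pairs at once, and
  also the unitaries \<open>U \<beta>\<^sub>g(U)\<^sup>*\<close>, since these form a strictly continuous cocycle that can be compared
  with the constant cocycle \<open>1\<close>.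

  The argument uses that each \<open>\<beta>\<^sub>g\<close> is isometric. This is obtained without spectral theory:
  for self-adjoint \<open>a\<close> of norm less than one, \<open>a\<close> is the imaginary part of a unitary
  \<open>1 - k + i a\<close> with \<open>k\<close> in the algebra, and *-homomorphisms preserve this property.
\<close>

section \<open>Contractivity of *-homomorphisms\<close>

lemma star_one: "star (1::'b::cstar_algebra multiplier) = 1"
  by (rule multiplier_eqI) (simp add: star_conj.rep_eq star_star)

lemma norm_one_multiplier_le: "norm (1::'b::cstar_algebra multiplier) \<le> 1"
  unfolding norm_multiplier_def by (rule norm_blinfun_bound) simp_all

lemma norm_le_one_if_star_mult_eq_one:
  fixes u :: "'b::cstar_algebra multiplier"
  assumes "star u * u = 1"
  shows "norm u \<le> 1"
proof -
  have "(norm u)\<^sup>2 \<le> 1\<^sup>2"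
    using norm_one_multiplier_le[where 'b='b] by (simp add: assms flip: cstar_identity)
  then show ?thesis by (rule power2_le_imp_le) simp
qed

lemma mult_embed_add: "mult_embed (x + y) = mult_embed x + mult_embed y"
  and mult_embed_diff: "mult_embed (x - y) = mult_embed x - mult_embed y"
  and mult_embed_mult: "mult_embed (x * y) = mult_embed x * mult_embed y"
  and mult_embed_star: "mult_embed (star x) = star (mult_embed x)"
proof -
  show add: "mult_embed (x + y) = mult_embed x + mult_embed y" for x y :: 'a
    using star_hom_mult_embed by (auto simp: star_hom_def clinear_def)
  show "mult_embed (x - y) = mult_embed x - mult_embed y"
    using add[of "x - y" y] by simp
qed (use star_hom_mult_embed in \<open>auto simp: star_hom_def\<close>)

lemma mult_embed_inject: "mult_embed x = mult_embed y \<longleftrightarrow> x = y"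
  by (metis eq_iff_diff_eq_0 mult_embed_diff norm_eq_zero norm_mult_embed)

text \<open>A self-adjoint \<open>T\<close> that has a self-adjoint commuting partner \<open>S\<close> with \<open>S\<^sup>2 + T\<^sup>2 = 1\<close> is the
  imaginary part of the unitary \<open>S + i T\<close>. This replaces the spectral radius in bounding norms.\<close>

lemma norm_le_one_if_sum_squares_eq_one:
  fixes S T :: "'b::cstar_algebra multiplier"
  assumes S: "star S = S" and T: "star T = T" and comm: "S * T = T * S"
    and sq: "S * S + T * T = 1"
  shows "norm T \<le> 1"
proof -
  define u where "u = S + \<i> *\<^sub>C T"
  define u' where "u' = S + (- \<i>) *\<^sub>C T"
  have neg: "(- \<i>) *\<^sub>C x + \<i> *\<^sub>C x = 0" for x :: "'b multiplier"
    using scaleC_add_left[of "- \<i>" \<i> x] scaleC_of_real[of 0 x] by simp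
  have one: "(1::complex) *\<^sub>C x = x" for x :: "'b multiplier"
    using scaleC_of_real[of 1 x] by simp
  have su: "star u = u'" and su': "star u' = u"
    by (simp_all add: u_def u'_def star_add star_scaleC S T)
  have "u' * u = S * S + T * T + ((- \<i>) *\<^sub>C (T * S) + \<i> *\<^sub>C (T * S))"
    by (simp add: u_def u'_def distrib_left distrib_right mult_scaleC_left mult_scaleC_right
        scaleC_scaleC scaleC_add_right comm one ac_simps)
  then have 1: "u' * u = 1" by (simp add: neg sq)
  have "u * u' = S * S + T * T + ((- \<i>) *\<^sub>C (T * S) + \<i> *\<^sub>C (T * S))"
    by (simp add: u_def u'_def distrib_left distrib_right mult_scaleC_left mult_scaleC_right
        scaleC_scaleC scaleC_add_right comm one ac_simps)
  then have 2: "u * u' = 1" by (simp add: neg sq)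
  have n: "norm u \<le> 1" "norm u' \<le> 1"
    using 1 2 by (auto intro!: norm_le_one_if_star_mult_eq_one simp: su su')
  have "\<i> *\<^sub>C T = (- \<i>) *\<^sub>C T + (2 * \<i>) *\<^sub>C T"
    using scaleC_add_left[of "- \<i>" "2 * \<i>" T] by simp
  then have "u = u' + (2 * \<i>) *\<^sub>C T"
    unfolding u_def u'_def by (metis add.assoc)
  then have "2 * norm T = norm (u - u')" by (simp add: norm_scaleC norm_mult)
  also have "\<dots> \<le> 2" using norm_triangle_ineq4[of u u'] n by simp
  finally show ?thesis by simp
qed

text \<open>The element \<open>1 - k\<close> is a square root of \<open>1 - a\<^sup>2\<close>. As \<open>k = (a\<^sup>2 + k\<^sup>2) / 2\<close> is a fixed-point
  equation for a contraction of the ball of radius \<open>norm a\<close>, it can be solved inside the non-unital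
  algebra.\<close>

lemma one_minus_square_has_sqrt:
  fixes a :: "'b::cstar_algebra"
  assumes sa: "star a = a" and less: "norm a < 1"
  obtains k where "star k = k" "k * a = a * k" "k + k = a * a + k * k"
proof -
  define \<Phi> where "\<Phi> k = (1/2) *\<^sub>R (a * a + k * k)" for k
  define X where "X = {k. norm k \<le> norm a \<and> star k = k \<and> k * a = a * k}"
  have "closed X"
    unfolding X_def
    by (intro closed_Collect_conj closed_Collect_le closed_Collect_eq continuous_intros
        linear_continuous_on bounded_linear_star)
  then have "complete X" by (simp add: complete_eq_closed)
  moreover have "X \<noteq> {}" by (auto simp: X_def intro!: exI[of _ 0])
  moreover have "\<Phi> ` X \<subseteq> X"
  proof clarify
    fix k assume "k \<in> X"
    then have k: "norm k \<le> norm a" "star k = k" "k * a = a * k" by (auto simp: X_def)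
    have "norm (a * a + k * k) \<le> norm a * norm a + norm k * norm k"
      by (intro order.trans[OF norm_triangle_ineq] add_mono norm_mult_ineq)
    also have "\<dots> \<le> norm a + norm a"
      using k(1) less
      by (intro add_mono mult_left_le order.trans[OF mult_mono[OF k(1) k(1)]]) auto
    finally have "norm (\<Phi> k) \<le> norm a" by (simp add: \<Phi>_def)
    moreover have "star (\<Phi> k) = \<Phi> k"
      by (simp add: \<Phi>_def star_scaleR star_add star_mult sa k)
    moreover have "k * (k * a) = a * (k * k)" by (metis k(3) mult.assoc)
    then have "\<Phi> k * a = a * \<Phi> k"
      by (simp add: \<Phi>_def distrib_left distrib_right mult.assoc)
    ultimately show "\<Phi> k \<in> X" by (simp add: X_def)
  qed
  moreover have "dist (\<Phi> k) (\<Phi> l) \<le> norm a * dist k l" if "k \<in> X" "l \<in> X" for k l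
  proof -
    have "\<Phi> k - \<Phi> l = (1/2) *\<^sub>R (k * (k - l) + (k - l) * l)"
      by (simp add: \<Phi>_def algebra_simps flip: scaleR_add_right scaleR_diff_right)
    then have "norm (\<Phi> k - \<Phi> l) \<le> (norm (k * (k - l)) + norm ((k - l) * l)) / 2"
      using norm_triangle_ineq[of "k * (k - l)" "(k - l) * l"] by simp
    also have "norm (k * (k - l)) \<le> norm a * norm (k - l)"
      using that by (intro order.trans[OF norm_mult_ineq] mult_right_mono) (auto simp: X_def)
    also have "norm ((k - l) * l) \<le> norm (k - l) * norm a"
      using that by (intro order.trans[OF norm_mult_ineq] mult_left_mono) (auto simp: X_def)
    finally show ?thesis by (simp add: dist_norm)
  qed
  ultimately have "\<exists>!k\<in>X. \<Phi> k = k"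
    using less by (intro Banach_fix[where c = "norm a"]) auto
  then obtain k where "k \<in> X" and fp: "\<Phi> k = k" by blast
  moreover have "k + k = a * a + k * k"
    using arg_cong[OF fp, of "\<lambda>x. 2 *\<^sub>R x"] by (simp add: \<Phi>_def scaleR_2)
  ultimately show thesis using that by (auto simp: X_def)
qed

text \<open>Both ingredients above are algebraic identities, so a *-homomorphism transports the square
  root and with it the bound on the norm; the C*-identity reduces the general case to
  self-adjoint elements.\<close>

theorem norm_star_hom_le:
  fixes f :: "'a::cstar_algebra \<Rightarrow> 'b::cstar_algebra"
  assumes f: "star_hom f"
  shows "norm (f x) \<le> norm x"
proof -
  have add: "f (x + y) = f x + f y" and sc: "f (c *\<^sub>C x) = c *\<^sub>C f x"
    and mult: "f (x * y) = f x * f y" and star: "f (star x) = star (f x)" for x y c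
    using f by (auto simp: star_hom_def clinear_def)
  have unit_ball: "norm (f a) \<le> 1" if a: "star a = a" "norm a < 1" for a
  proof -
    obtain k where k: "star k = k" "k * a = a * k" "k + k = a * a + k * k"
      using one_minus_square_has_sqrt[OF a] by blast
    define K where "K = mult_embed (f k)"
    define T where "T = mult_embed (f a)"
    have K: "star K = K" "K * T = T * K" "K + K = T * T + K * K"
      and T: "star T = T"
      using k a unfolding K_def T_def
      by (metis mult_embed_add mult_embed_mult mult_embed_star add mult star)+
    have "(1 - K) * (1 - K) + T * T = 1 - (K + K) + (T * T + K * K)"
      by (simp add: algebra_simps)
    then have "(1 - K) * (1 - K) + T * T = 1"
      by (simp add: K(3))
    moreover have "star (1 - K) = 1 - K" "(1 - K) * T = T * (1 - K)"
      by (simp_all add: star_diff star_one K algebra_simps)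
    ultimately have "norm T \<le> 1" using T by (intro norm_le_one_if_sum_squares_eq_one)
    then show ?thesis by (simp add: T_def norm_mult_embed)
  qed
  have self_adjoint: "norm (f a) \<le> norm a" if a: "star a = a" for a
  proof (rule dense_ge)
    fix t assume t: "norm a < t"
    then have "t > 0" using norm_ge_zero[of a] by linarith
    have "norm (f (inverse t *\<^sub>R a)) \<le> 1"
      using t \<open>t > 0\<close> by (intro unit_ball) (auto simp: star_scaleR a field_simps)
    also have "f (inverse t *\<^sub>R a) = inverse t *\<^sub>R f a"
      by (metis sc scaleC_of_real)
    finally show "norm (f a) \<le> t" using \<open>t > 0\<close> by (simp add: field_simps)
  qed
  have "(norm (f x))\<^sup>2 = norm (f (star x * x))"
    by (simp add: mult star cstar_identity)
  also have "\<dots> \<le> (norm x)\<^sup>2"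
    using self_adjoint[of "star x * x"] by (simp add: star_mult star_star cstar_identity)
  finally show ?thesis by (rule power2_le_imp_le) simp
qed

lemma star_hom_linear:
  assumes "star_hom f" shows "linear f"
  using assms by (intro linearI) (auto simp: star_hom_def clinear_def simp flip: scaleC_of_real)

lemma bounded_linear_star_hom:
  assumes "star_hom f" shows "bounded_linear f"
  using star_hom_linear[OF assms] norm_star_hom_le[OF assms]
  by (intro bounded_linear.intro bounded_linear_axioms.intro exI[of _ 1]) auto

lemma star_automorphism_inv:
  assumes "star_automorphism f" shows "star_automorphism (inv f)"
proof -
  have f: "star_hom f" "bij f" using assms by (auto simp: star_automorphism_def)
  have ff [simp]: "f (inv f x) = x" "inv f (f x) = x" for x
    using f(2) by (auto simp: bij_def surj_f_inv_f)
  show ?thesis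
    using f unfolding star_automorphism_def star_hom_def clinear_def
    by (intro conjI allI bij_imp_bij_inv) (metis ff)+
qed

lemma norm_star_automorphism:
  assumes f: "star_automorphism f" shows "norm (f x) = norm x"
proof (rule antisym)
  show "norm (f x) \<le> norm x"
    using f by (intro norm_star_hom_le) (simp add: star_automorphism_def)
  have "inv f (f x) = x" using f by (simp add: star_automorphism_def bij_def)
  then show "norm x \<le> norm (f x)"
    using norm_star_hom_le[of "inv f" "f x"] star_automorphism_inv[OF f]
    by (simp add: star_automorphism_def)
qed


section \<open>The extension of an automorphism to the multiplier algebra\<close>

lemma
  assumes f: "star_automorphism f"
  shows lmult_mult_extend: "lmult (mult_extend f m) b = f (lmult m (inv f b))"
    and rmult_mult_extend: "rmult (mult_extend f m) b = f (rmult m (inv f b))"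
    and mult_extend_embed: "mult_extend f (mult_embed c) = mult_embed (f c)"
proof -
  have "bounded_linear f" "bounded_linear (inv f)"
    using f star_automorphism_inv[OF f]
    by (auto intro!: bounded_linear_star_hom simp: star_automorphism_def)
  from mult_extend[OF f this]
  show "lmult (mult_extend f m) b = f (lmult m (inv f b))"
    "rmult (mult_extend f m) b = f (rmult m (inv f b))"
    "mult_extend f (mult_embed c) = mult_embed (f c)" by auto
qed

lemma
  assumes f: "star_automorphism f"
  shows mult_extend_mult: "mult_extend f (m * n) = mult_extend f m * mult_extend f n"
    and mult_extend_star: "mult_extend f (star m) = star (mult_extend f m)"
    and mult_extend_one: "mult_extend f 1 = 1"
    and mult_extend_diff: "mult_extend f (m - n) = mult_extend f m - mult_extend f n"
proof -
  have ff [simp]: "f (inv f x) = x" "inv f (f x) = x" for x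
    using f by (auto simp: star_automorphism_def bij_def surj_f_inv_f)
  have star [simp]: "f (star x) = star (f x)" "inv f (star x) = star (inv f x)" for x
    using f star_automorphism_inv[OF f] by (auto simp: star_automorphism_def star_hom_def)
  have diff [simp]: "f (x - y) = f x - f y" for x y
    using f by (intro linear_diff star_hom_linear) (simp add: star_automorphism_def)
  note [simp] = lmult_mult_extend[OF f] rmult_mult_extend[OF f]
  show "mult_extend f (m * n) = mult_extend f m * mult_extend f n"
    "mult_extend f (star m) = star (mult_extend f m)"
    "mult_extend f 1 = 1"
    "mult_extend f (m - n) = mult_extend f m - mult_extend f n"
    by (auto intro!: multiplier_eqI simp: star_conj.rep_eq blinfun.diff_left)
qed

lemma mult_extend_comp:
  assumes "star_automorphism f" "star_automorphism g" "star_automorphism (f \<circ> g)"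
  shows "mult_extend (f \<circ> g) m = mult_extend f (mult_extend g m)"
proof -
  have "inv (f \<circ> g) = inv g \<circ> inv f"
    using assms by (intro o_inv_distrib) (auto simp: star_automorphism_def)
  then show ?thesis
    by (intro multiplier_eqI) (simp add: lmult_mult_extend assms)
qed

lemma
  assumes "unitary u"
  shows norm_unitary_mult: "norm (u * m) = norm m"
    and norm_mult_star_unitary: "norm (m * star u) = norm m"
proof -
  have eq: "norm (u * m) = norm m" for m
  proof -
    have "star (u * m) * (u * m) = star m * (star u * u) * m"
      by (simp add: star_mult mult.assoc)
    then have "(norm (u * m))\<^sup>2 = (norm m)\<^sup>2"
      using assms unfolding unitary_def by (metis cstar_identity mult_1_right)
    then show ?thesis by simp
  qed
  show "norm (u * m) = norm m" by (rule eq)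
  have "norm (m * star u) = norm (u * star m)"
    by (metis norm_star star_mult star_star)
  then show "norm (m * star u) = norm m" by (simp add: eq)
qed


section \<open>Continuity of contractive families\<close>

text \<open>Strict continuity of multipliers and point-norm continuity of actions control fixed
  arguments only. Since the families are contractive, the argument may move with the group element.\<close>

lemma continuous_on_contractive_family:
  fixes T :: "'g::topological_space \<Rightarrow> 'b::real_normed_vector \<Rightarrow> 'c::real_normed_vector"
  assumes contr: "\<And>g x y. norm (T g x - T g y) \<le> norm (x - y)"
    and T: "\<And>x. continuous_on UNIV (\<lambda>g. T g x)"
    and F: "continuous_on UNIV F"
  shows "continuous_on UNIV (\<lambda>g. T g (F g))"
proof -
  have "((\<lambda>h. T h (F h)) \<longlongrightarrow> T g (F g)) (at g)" for g
  proof -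
    have "((\<lambda>h. norm (F h - F g)) \<longlongrightarrow> 0) (at g)"
      using F by (simp add: continuous_on_def LIM_zero tendsto_norm_zero)
    then have "((\<lambda>h. T h (F h) - T h (F g)) \<longlongrightarrow> 0) (at g)"
      by (rule Lim_null_comparison[OF always_eventually, rotated]) (simp add: contr)
    moreover have "((\<lambda>h. T h (F g)) \<longlongrightarrow> T g (F g)) (at g)"
      using T by (simp add: continuous_on_def)
    ultimately have "((\<lambda>h. (T h (F h) - T h (F g)) + T h (F g)) \<longlongrightarrow> 0 + T g (F g)) (at g)"
      by (rule tendsto_add)
    then show ?thesis by simp
  qed
  then show ?thesis by (simp add: continuous_on_def)
qed

lemma
  assumes u: "\<And>g. unitary (u g)" "strictly_continuous u" and F: "continuous_on UNIV F"
  shows continuous_on_lmult_unitary: "continuous_on UNIV (\<lambda>g. lmult (u g) (F g))"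
    and continuous_on_rmult_unitary: "continuous_on UNIV (\<lambda>g. rmult (u g) (F g))"
proof -
  have u1: "norm (u g) \<le> 1" for g
    using u(1) by (auto intro: norm_le_one_if_star_mult_eq_one simp: unitary_def)
  have contr: "norm (blinfun_apply A x - blinfun_apply A y) \<le> norm (x - y)"
    if "norm A \<le> 1" for A :: "'b \<Rightarrow>\<^sub>L 'b" and x y
  proof -
    have "norm (blinfun_apply A (x - y)) \<le> norm A * norm (x - y)" by (rule norm_blinfun)
    also have "\<dots> \<le> norm (x - y)" using that by (simp add: mult_left_le_one_le)
    finally show ?thesis by (simp add: blinfun.diff_right)
  qed
  have "norm (lmult (u g)) \<le> 1" "norm (rmult (u g)) \<le> 1" for g
    using u1[of g] by (simp_all add: norm_rmult norm_multiplier_def)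
  note contr = this[THEN contr]
  show "continuous_on UNIV (\<lambda>g. lmult (u g) (F g))"
    by (rule continuous_on_contractive_family[OF contr(1) _ F])
      (use u(2) in \<open>simp add: strictly_continuous_def\<close>)
  show "continuous_on UNIV (\<lambda>g. rmult (u g) (F g))"
    by (rule continuous_on_contractive_family[OF contr(2) _ F])
      (use u(2) in \<open>simp add: strictly_continuous_def\<close>)
qed

lemma continuous_on_action:
  assumes \<beta>: "is_action \<beta>" and F: "continuous_on UNIV F"
  shows "continuous_on UNIV (\<lambda>g. \<beta> g (F g))"
proof (rule continuous_on_contractive_family[OF _ _ F])
  fix g x y
  have aut: "star_automorphism (\<beta> g)" using \<beta> by (simp add: is_action_def)
  then have "\<beta> g x - \<beta> g y = \<beta> g (x - y)"
    by (intro linear_diff[symmetric] star_hom_linear) (simp add: star_automorphism_def)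
  then show "norm (\<beta> g x - \<beta> g y) \<le> norm (x - y)"
    by (simp add: norm_star_automorphism[OF aut])
qed (use \<beta> in \<open>simp add: is_action_def\<close>)


section \<open>The gliding hump\<close>

text \<open>If \<open>f\<close> jumps by \<open>\<epsilon>\<close> arbitrarily close to the neutral element then, by homogeneity, it does so
  near every point, and small steps that all jump can be concatenated. When a step tends to zero the
  increment tends to zero strictly, hence it can be chosen almost orthogonal to the finitely many
  earlier increments. Local compactness makes the resulting walk accumulate.\<close>

lemma homogeneous_strictly_continuous_imp_continuous:
  fixes f :: "'g::{topological_group_add, t2_space, first_countable_topology} \<Rightarrow> 'b::cstar_algebra"
  assumes lc: "locally_compact_space (euclidean :: 'g topology)"
    and strict: "\<And>b. continuous_on UNIV (\<lambda>g. b * f g)"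
    and hom: "\<And>g h. norm (f (g + h) - f g) = \<rho> h"
  shows "continuous_on UNIV f"
proof -
  have "(\<rho> \<longlongrightarrow> 0) (nhds 0)"
  proof (rule ccontr)
    assume "\<not> (\<rho> \<longlongrightarrow> 0) (nhds 0)"
    moreover have nonneg: "\<rho> g \<ge> 0" for g by (metis hom norm_ge_zero)
    ultimately obtain \<epsilon> where \<epsilon>: "\<epsilon> > 0" and freq: "\<exists>\<^sub>F g in nhds 0. \<epsilon> \<le> \<rho> g"
      by (auto simp: tendsto_iff frequently_def not_le)
    obtain U K where U: "open U" "(0::'g) \<in> U" "U \<subseteq> K" and K: "compact K"
      using lc unfolding locally_compact_space_def by simp (metis that)
    obtain V where V: "\<And>n. open (V n)" "\<And>n. (0::'g) \<in> V n"
      "\<And>S. open S \<Longrightarrow> 0 \<in> S \<Longrightarrow> \<forall>\<^sub>F n in sequentially. V n \<subseteq> S"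
      by (rule countable_basis_at_decseq[of "0::'g"]) blast
    \<comment> \<open>The bounds \<open>\<delta> / 2\<^sup>n\<close> below sum to \<open>2 \<delta>\<close>, which is half of the lower bound \<open>\<epsilon>\<^sup>2\<close> for the
      diagonal terms \<open>x\<^sub>k\<^sup>* x\<^sub>k\<close>.\<close>
    define \<delta> where "\<delta> = \<epsilon>\<^sup>2 / 4"
    have "\<delta> > 0" using \<epsilon> by (simp add: \<delta>_def)
    define Q where "Q n s s' \<longleftrightarrow> \<epsilon> \<le> norm (f (fst s') - f (fst s)) \<and> - fst s + fst s' \<in> V n \<and>
        (\<forall>y\<in>snd s. norm (star y * (f (fst s') - f (fst s))) < \<delta> / 2 ^ n) \<and>
        snd s' = insert (f (fst s') - f (fst s)) (snd s)"
      for n and s s' :: "'g \<times> 'b set"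
    \<comment> \<open>The choice of a step depends on all earlier increments, so the recursion carries them
      along with the current point.\<close>
    have "\<exists>s. \<forall>n. (fst (s n) \<in> U \<and> finite (snd (s n))) \<and> Q n (s n) (s (Suc n))"
    proof (rule dependent_nat_choice)
      show "\<exists>s. fst s \<in> U \<and> finite (snd s)" using U by (auto intro!: exI[of _ 0])
    next
      fix s :: "'g \<times> 'b set" and n :: nat
      assume s: "fst s \<in> U \<and> finite (snd s)"
      have lim: "((\<lambda>g. fst s + g) \<longlongrightarrow> fst s) (nhds 0)"
        using tendsto_add[OF tendsto_const[of "fst s"] filterlim_ident[of "nhds 0"]] by simp
      have "\<forall>\<^sub>F g in nhds 0. fst s + g \<in> U"
        using lim U s by (auto simp: tendsto_def)
      moreover have "\<forall>\<^sub>F g in nhds 0. g \<in> V n"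
        using V by (auto simp: eventually_nhds)
      moreover have "\<forall>\<^sub>F g in nhds 0. norm (star y * (f (fst s + g) - f (fst s))) < \<delta> / 2 ^ n" for y
      proof -
        have "((\<lambda>g. star y * f (fst s + g)) \<longlongrightarrow> star y * f (fst s)) (nhds 0)"
          using continuous_on_tendsto_compose[OF strict lim] by simp
        then have "((\<lambda>g. norm (star y * (f (fst s + g) - f (fst s)))) \<longlongrightarrow> 0) (nhds 0)"
          by (simp add: right_diff_distrib LIM_zero tendsto_norm_zero)
        then show ?thesis using \<open>\<delta> > 0\<close> by (auto dest!: order_tendstoD(2)[of _ _ _ "\<delta> / 2 ^ n"])
      qed
      then have "\<forall>\<^sub>F g in nhds 0. \<forall>y\<in>snd s. norm (star y * (f (fst s + g) - f (fst s))) < \<delta> / 2 ^ n"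
        using s by (intro eventually_ball_finite) auto
      ultimately have "\<forall>\<^sub>F g in nhds 0. fst s + g \<in> U \<and> g \<in> V n \<and>
          (\<forall>y\<in>snd s. norm (star y * (f (fst s + g) - f (fst s))) < \<delta> / 2 ^ n)"
        by (auto intro: eventually_conj)
      from frequently_ex[OF frequently_eventually_frequently[OF freq this]]
      obtain g where g: "\<epsilon> \<le> \<rho> g" "fst s + g \<in> U" "g \<in> V n"
        "\<forall>y\<in>snd s. norm (star y * (f (fst s + g) - f (fst s))) < \<delta> / 2 ^ n"
        by blast
      then show "\<exists>s'. (fst s' \<in> U \<and> finite (snd s')) \<and> Q n s s'"
        using s by (intro exI[of _ "(fst s + g, insert (f (fst s + g) - f (fst s)) (snd s))"])
          (simp add: Q_def hom add.assoc[symmetric])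
    qed
    then obtain s where s: "\<And>n. fst (s n) \<in> U" "\<And>n. Q n (s n) (s (Suc n))" by blast
    define h where "h n = fst (s n)" for n
    define x where "x n = f (h (Suc n)) - f (h n)" for n
    have "x j \<in> snd (s k)" if "j < k" for j k
      using that by (induction k) (use s(2) in \<open>auto simp: Q_def x_def h_def less_Suc_eq\<close>)
    then have later: "norm (star (x j) * x k) < \<delta> / 2 ^ k" if "j < k" for j k
      using s(2)[of k] that by (simp add: Q_def x_def h_def)
    have orth: "norm (star (x k) * x j) \<le> \<delta> / 2 ^ j" if "j \<noteq> k" for j k
    proof (cases "j < k")
      case True
      have "norm (star (x k) * x j) = norm (star (x j) * x k)"
        by (metis norm_star star_mult star_star)
      also have "\<dots> \<le> \<delta> / 2 ^ k" using later[OF True] by simp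
      also have "\<dots> \<le> \<delta> / 2 ^ j"
        using True \<open>\<delta> > 0\<close> by (intro divide_left_mono power_increasing) auto
      finally show ?thesis .
    qed (use later[of k j] that in auto)
    have big: "\<epsilon> \<le> norm (x k)" for k
      using s(2)[of k] by (simp add: Q_def x_def h_def)
    have sum: "\<epsilon>\<^sup>2 / 2 \<le> norm (star (x k) * (f (h m) - f (h 0)))" if "k < m" for k m
    proof -
      have "f (h m) - f (h 0) = (\<Sum>j<m. x j)"
        using sum_lessThan_telescope[of "\<lambda>n. f (h n)"] by (simp add: x_def)
      also have "\<dots> = x k + (\<Sum>j\<in>{..<m} - {k}. x j)"
        using that by (intro sum.remove) auto
      finally have eq: "star (x k) * (f (h m) - f (h 0)) =
          star (x k) * x k + (\<Sum>j\<in>{..<m} - {k}. star (x k) * x j)"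
        by (simp add: distrib_left sum_distrib_left)
      have "norm (\<Sum>j\<in>{..<m} - {k}. star (x k) * x j) \<le> (\<Sum>j\<in>{..<m} - {k}. \<delta> / 2 ^ j)"
        by (intro sum_norm_le orth) auto
      also have "\<dots> \<le> (\<Sum>j<m. \<delta> / 2 ^ j)"
        using \<open>\<delta> > 0\<close> by (intro sum_mono2) auto
      also have "\<dots> = \<delta> * (\<Sum>j<m. (1/2) ^ j)"
        by (simp add: sum_distrib_left power_divide)
      also have "\<dots> \<le> \<delta> * 2"
        using \<open>\<delta> > 0\<close> by (intro mult_left_mono) (simp_all add: geometric_sum)
      finally have "norm (\<Sum>j\<in>{..<m} - {k}. star (x k) * x j) \<le> \<epsilon>\<^sup>2 / 2" by (simp add: \<delta>_def)
      moreover have "\<epsilon>\<^sup>2 \<le> norm (star (x k) * x k)"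
        unfolding cstar_identity using big \<epsilon> by (intro power_mono) auto
      ultimately show ?thesis
        using norm_diff_ineq[of "star (x k) * x k" "\<Sum>j\<in>{..<m} - {k}. star (x k) * x j"]
        unfolding eq by linarith
    qed
    obtain l r where r: "strict_mono r" and "(h \<circ> r) \<longlonglongrightarrow> l"
      using compact_imp_seq_compact[OF K] s(1) U(3)
      unfolding seq_compact_def h_def by (metis subsetD)
    then have lim: "(\<lambda>i. h (r i)) \<longlonglongrightarrow> l" by (simp add: o_def)
    \<comment> \<open>The steps shrink to the neutral element, so both ends of the step with number \<open>r i\<close>
      converge to \<open>l\<close>, and its increment tends to zero strictly.\<close>
    have "(\<lambda>n. - h n + h (Suc n)) \<longlonglongrightarrow> 0"
    proof (rule topological_tendstoI)
      fix S :: "'g set" assume "open S" "0 \<in> S"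
      then have "\<forall>\<^sub>F n in sequentially. V n \<subseteq> S" by (rule V)
      then show "\<forall>\<^sub>F n in sequentially. - h n + h (Suc n) \<in> S"
        by eventually_elim (use s(2) in \<open>auto simp: Q_def h_def\<close>)
    qed
    then have "(\<lambda>i. - h (r i) + h (Suc (r i))) \<longlonglongrightarrow> 0"
      using LIMSEQ_subseq_LIMSEQ[OF _ r] by (fastforce simp: o_def)
    from tendsto_add[OF lim this] have lim': "(\<lambda>i. h (Suc (r i))) \<longlonglongrightarrow> l"
      by (simp add: add.assoc[symmetric])
    have f_lim: "(\<lambda>i. b * f (h (r i))) \<longlonglongrightarrow> b * f l" "(\<lambda>i. b * f (h (Suc (r i)))) \<longlonglongrightarrow> b * f l" for b
      using continuous_on_tendsto_compose[OF strict lim] continuous_on_tendsto_compose[OF strict lim']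
      by simp_all
    define a where "a = f l - f (h 0)"
    have lower: "\<epsilon>\<^sup>2 / 2 \<le> norm (star (x k) * a)" for k
    proof (rule Lim_bounded2)
      show "(\<lambda>i. norm (star (x k) * (f (h (r i)) - f (h 0)))) \<longlonglongrightarrow> norm (star (x k) * a)"
        unfolding a_def right_diff_distrib by (intro tendsto_intros f_lim)
      show "\<forall>i\<ge>Suc k. \<epsilon>\<^sup>2 / 2 \<le> norm (star (x k) * (f (h (r i)) - f (h 0)))"
        using seq_suble[OF r] by (intro allI impI sum) (meson Suc_le_lessD less_le_trans)
    qed
    have "(\<lambda>i. star a * f (h (Suc (r i))) - star a * f (h (r i))) \<longlonglongrightarrow> 0"
      using tendsto_diff[OF f_lim(2) f_lim(1), of "star a" "star a"] by simp
    then have "(\<lambda>i. norm (star a * x (r i))) \<longlonglongrightarrow> 0"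
      unfolding x_def right_diff_distrib by (rule tendsto_norm_zero)
    moreover have "norm (star a * x k) = norm (star (x k) * a)" for k
      by (metis norm_star star_mult star_star)
    ultimately have "(\<lambda>i. norm (star (x (r i)) * a)) \<longlonglongrightarrow> 0" by simp
    then have "\<epsilon>\<^sup>2 / 2 \<le> 0" by (rule Lim_bounded2) (use lower in auto)
    then show False using \<epsilon> by simp
  qed
  moreover have "((\<lambda>h. - g + h) \<longlongrightarrow> 0) (at g)" for g :: 'g
    using tendsto_add[OF tendsto_const[of "- g"] tendsto_ident_at[of g UNIV]] by simp
  ultimately have "((\<lambda>h. \<rho> (- g + h)) \<longlongrightarrow> 0) (at g)" for g
    by (blast intro: filterlim_compose)
  moreover have "norm (f h - f g) = \<rho> (- g + h)" for g h
    using hom[of g "- g + h"] by (simp add: add.assoc[symmetric])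
  ultimately have "((\<lambda>h. norm (f h - f g)) \<longlongrightarrow> 0) (at g)" for g
    by simp
  then show ?thesis
    by (auto simp: continuous_on_def intro: LIM_zero_cancel tendsto_norm_zero_cancel)
qed


section \<open>Norm-continuity of differences of cocycles\<close>

text \<open>The quotient \<open>u\<^sub>g v\<^sub>g\<^sup>*\<close> is a cocycle for the action perturbed by \<open>v\<close>. Passing to it turns the
  difference of two cocycles into the distance of one cocycle from \<open>1\<close>, and that distance is
  homogeneous.\<close>

theorem cocycle_diff_norm_continuous:
  fixes \<beta> :: "'g::{topological_group_add, t2_space, first_countable_topology} \<Rightarrow>
      'b::cstar_algebra \<Rightarrow> 'b"
  assumes lc: "locally_compact_space (euclidean :: 'g topology)"
    and \<beta>: "is_action \<beta>"
    and u: "is_cocycle \<beta> u" "strictly_continuous u"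
    and v: "is_cocycle \<beta> v" "strictly_continuous v"
    and diff: "\<And>g. u g - v g \<in> range mult_embed"
  shows "continuous_on UNIV (\<lambda>g. u g - v g)"
proof -
  have aut: "star_automorphism (\<beta> g)" for g using \<beta> by (simp add: is_action_def)
  have uu: "unitary (u g)" and vu: "unitary (v g)" for g
    using u v by (auto simp: is_cocycle_def)
  have "\<exists>x. mult_embed x = u g * star (v g) - 1" for g
  proof -
    obtain d where d: "u g - v g = mult_embed d" using diff by blast
    have "u g * star (v g) - 1 = (u g - v g) * star (v g)"
      using vu by (simp add: left_diff_distrib unitary_def)
    also have "\<dots> = mult_embed (rmult (star (v g)) d)" unfolding d by (rule mult_embed_rmult)
    finally show ?thesis by metis
  qed
  then obtain f where f: "\<And>g. mult_embed (f g) = u g * star (v g) - 1" by metis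
  have "continuous_on UNIV f"
  proof (rule homogeneous_strictly_continuous_imp_continuous[OF lc])
    fix b
    have "b * f g = star (lmult (v g) (star (rmult (u g) b))) - b" for g
    proof -
      have "mult_embed (b * f g) = mult_embed b * u g * star (v g) - mult_embed b"
        by (simp add: mult_embed_mult f right_diff_distrib mult.assoc)
      also have "\<dots> = mult_embed (rmult (star (v g)) (rmult (u g) b) - b)"
        by (simp only: mult_embed_rmult mult_embed_diff)
      finally show ?thesis by (simp add: mult_embed_inject star_conj.rep_eq)
    qed
    moreover have "continuous_on UNIV (\<lambda>g. star (lmult (v g) (star (rmult (u g) b))) - b)"
    proof -
      note star_cont = bounded_linear.continuous_on[OF bounded_linear_star]
      have "continuous_on UNIV (\<lambda>g. star (rmult (u g) b))"
        using u(2) unfolding strictly_continuous_def by (intro star_cont) blast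
      then have "continuous_on UNIV (\<lambda>g. star (lmult (v g) (star (rmult (u g) b))))"
        by (rule star_cont[OF continuous_on_lmult_unitary[OF vu v(2)]])
      then show ?thesis by (intro continuous_on_diff continuous_on_const)
    qed
    ultimately show "continuous_on UNIV (\<lambda>g. b * f g)" by simp
  next
    fix g h
    let ?E = "mult_extend (\<beta> g)"
    have "mult_embed (f (g + h) - f g) = u (g + h) * star (v (g + h)) - u g * star (v g)"
      by (simp add: mult_embed_diff f)
    also have "\<dots> = u g * ?E (u h * star (v h) - 1) * star (v g)"
      using u v by (simp add: is_cocycle_def mult_extend_mult[OF aut] mult_extend_star[OF aut]
          mult_extend_one[OF aut] mult_extend_diff[OF aut] star_mult algebra_simps)
    also have "\<dots> = u g * mult_embed (\<beta> g (f h)) * star (v g)"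
      by (simp add: mult_extend_embed[OF aut] flip: f)
    finally have "norm (f (g + h) - f g) = norm (u g * mult_embed (\<beta> g (f h)) * star (v g))"
      by (metis norm_mult_embed)
    then show "norm (f (g + h) - f g) = norm (f h)"
      by (simp add: norm_mult_star_unitary vu norm_unitary_mult uu norm_mult_embed
          norm_star_automorphism[OF aut])
  qed
  then have "continuous_on UNIV (\<lambda>g. rmult (v g) (f g))"
    by (rule continuous_on_rmult_unitary[OF vu v(2)])
  then have "continuous_on UNIV (\<lambda>g. mult_embed (rmult (v g) (f g)))"
    by (rule bounded_linear.continuous_on[OF bounded_linear_star_hom[OF star_hom_mult_embed]])
  moreover have "mult_embed (rmult (v g) (f g)) = u g - v g" for g
    using vu by (simp add: f left_diff_distrib mult.assoc unitary_def flip: mult_embed_rmult)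
  ultimately show ?thesis by simp
qed

lemma coboundary_is_cocycle:
  assumes \<beta>: "is_action \<beta>" and U: "unitary U"
  shows "is_cocycle \<beta> (\<lambda>g. U * star (mult_extend (\<beta> g) U))"
proof -
  have aut: "star_automorphism (\<beta> g)" and comp: "\<beta> (g + h) = \<beta> g \<circ> \<beta> h" for g h
    using \<beta> by (auto simp: is_action_def)
  have ext: "unitary (mult_extend (\<beta> g) U)" for g
    using U unfolding unitary_def
    by (simp add: mult_extend_one[OF aut] flip: mult_extend_mult[OF aut] mult_extend_star[OF aut])
  have prod: "unitary (m * star n)" if "unitary m" "unitary n" for m n :: "'b multiplier"
    using that by (simp add: unitary_def star_mult star_star) (metis mult.assoc mult_1_right)
  have cancel: "star m * (m * n) = n" if "unitary m" for m n :: "'b multiplier"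
    using that by (simp add: unitary_def flip: mult.assoc)
  show ?thesis
    unfolding is_cocycle_def
  proof (intro conjI allI)
    show "unitary (U * star (mult_extend (\<beta> g) U))" for g using U ext by (rule prod)
    show "U * star (mult_extend (\<beta> (g + h)) U) =
        U * star (mult_extend (\<beta> g) U) * mult_extend (\<beta> g) (U * star (mult_extend (\<beta> h) U))" for g h
      using aut[of "g + h"] unfolding comp
      by (simp add: mult_extend_comp aut mult_extend_mult[OF aut] mult_extend_star[OF aut]
          cancel[OF ext] mult.assoc)
  qed
qed

text \<open>The map \<open>g \<mapsto> \<beta>\<^sub>g(m)\<close> is strictly but in general not norm continuous for a multiplier \<open>m\<close>:
  in \<open>\<beta>\<^sub>g(m) b = \<beta>\<^sub>g(m \<beta>\<^sub>g\<^sup>-\<^sup>1(b))\<close> the action is applied to elements of \<open>B\<close> only.\<close>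

lemma coboundary_strictly_continuous:
  assumes \<beta>: "is_action \<beta>"
  shows "strictly_continuous (\<lambda>g. U * star (mult_extend (\<beta> g) U))"
proof -
  have aut: "star_automorphism (\<beta> g)" and comp: "\<beta> (g + h) = \<beta> g \<circ> \<beta> h" for g h
    using \<beta> by (auto simp: is_action_def)
  have inv: "inv (\<beta> g) b = \<beta> (- g) b" for g b
  proof -
    have inj: "inj (\<beta> g)" for g using aut by (simp add: star_automorphism_def bij_def)
    have "\<beta> 0 (\<beta> 0 x) = \<beta> 0 x" for x using fun_cong[OF comp[of 0 0]] by simp
    then have "\<beta> 0 x = x" for x by (metis inj inj_def)
    then have "\<beta> g (\<beta> (- g) b) = b" using fun_cong[OF comp[of g "- g"]] by simp
    then show ?thesis using inj by (metis inv_f_f)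
  qed
  have inv_cont: "continuous_on UNIV (\<lambda>g. inv (\<beta> g) b)" for b
    unfolding inv
    using continuous_on_compose2[of UNIV "\<lambda>g. \<beta> g b" UNIV uminus] \<beta>
    by (simp add: is_action_def continuous_intros)
  have "continuous_on UNIV (\<lambda>g. \<beta> g (T (inv (\<beta> g) b)))" for T :: "'b \<Rightarrow>\<^sub>L 'b" and b
    by (intro continuous_on_action[OF \<beta>] blinfun.continuous_on continuous_on_const inv_cont)
  then show ?thesis
    unfolding strictly_continuous_def mult_extend_star[OF aut, symmetric]
    by (auto simp: lmult_mult_extend[OF aut] rmult_mult_extend[OF aut]
        simp del: lmult_star rmult_star
        intro!: blinfun.continuous_on continuous_on_const)
qed

lemma one_is_cocycle:
  assumes "is_action \<beta>"
  shows "is_cocycle \<beta> (\<lambda>g. 1)"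
  using assms by (simp add: is_cocycle_def is_action_def unitary_def star_one mult_extend_one)

theorem coboundary_norm_continuous:
  fixes \<beta> :: "'g::{topological_group_add, t2_space, first_countable_topology} \<Rightarrow>
      'b::cstar_algebra \<Rightarrow> 'b"
  assumes lc: "locally_compact_space (euclidean :: 'g topology)"
    and \<beta>: "is_action \<beta>" and U: "unitary U"
    and one_plus: "\<And>g. U * star (mult_extend (\<beta> g) U) \<in> unitaries_one_plus"
  shows "continuous_on UNIV (\<lambda>g. U * star (mult_extend (\<beta> g) U))"
proof -
  have "U * star (mult_extend (\<beta> g) U) - 1 \<in> range mult_embed" for g
    using one_plus[of g] by (auto simp: unitaries_one_plus_def)
  then have "continuous_on UNIV (\<lambda>g. U * star (mult_extend (\<beta> g) U) - 1)"
    by (intro cocycle_diff_norm_continuous[OF lc \<beta>] coboundary_is_cocycle one_is_cocycle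
        coboundary_strictly_continuous \<beta> U) (simp_all add: strictly_continuous_def)
  from continuous_on_add[OF this continuous_on_const[of _ 1]] show ?thesis by simp
qed

theorem proposition6p9:
  fixes \<beta> :: "'g::{topological_group_add, t2_space, second_countable_topology} \<Rightarrow>
      'b::cstar_algebra \<Rightarrow> 'b"
    and \<alpha> :: "'g \<Rightarrow> 'a::cstar_algebra \<Rightarrow> 'a"
    and \<gamma> :: "'g \<Rightarrow> 'c::cstar_algebra \<Rightarrow> 'c"
    and tensor :: "'c \<Rightarrow> ('h::complex_hilbert_space \<Rightarrow>\<^sub>L 'h) \<Rightarrow> 's::cstar_algebra"
    and \<gamma>s :: "'g \<Rightarrow> 's \<Rightarrow> 's"
  assumes "locally_compact_space (euclidean :: 'g topology)"
  shows
    "(is_action \<beta> \<and> \<not> has_unit TYPE('b) \<longrightarrow>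
        (\<forall>U :: 'b multiplier. unitary U \<and>
           (\<forall>g. U * star (mult_extend (\<beta> g) U) \<in> unitaries_one_plus) \<longrightarrow>
           continuous_on UNIV (\<lambda>g. U * star (mult_extend (\<beta> g) U))) \<and>
        (\<forall>u v :: 'g \<Rightarrow> 'b multiplier.
           is_cocycle \<beta> u \<and> strictly_continuous u \<and> is_cocycle \<beta> v \<and> strictly_continuous v \<and>
           (\<forall>g. u g - v g \<in> range mult_embed) \<longrightarrow>
           continuous_on UNIV (\<lambda>g. u g - v g)))
     \<and>
     (separable_space (euclidean :: 'a topology) \<and> separable_space (euclidean :: 'c topology) \<and>
      separable_infinite_dimensional TYPE('h) \<and>
      is_action \<alpha> \<and> is_action \<gamma> \<and> stabilization tensor \<and> stabilized_action tensor \<gamma> \<gamma>s \<longrightarrow>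
        (\<forall>\<phi>p up \<phi>m um.
           cuntz_pair \<alpha> \<gamma>s \<phi>p up \<phi>m um \<longleftrightarrow>
             cocycle_representation \<alpha> \<gamma>s \<phi>p up \<and> cocycle_representation \<alpha> \<gamma>s \<phi>m um \<and>
             (\<forall>a. \<phi>p a - \<phi>m a \<in> range mult_embed) \<and>
             (\<forall>g. up g - um g \<in> range mult_embed)))"
proof (intro conjI impI allI)
  fix U :: "'b multiplier"
  assume "is_action \<beta> \<and> \<not> has_unit TYPE('b)"
    and "unitary U \<and> (\<forall>g. U * star (mult_extend (\<beta> g) U) \<in> unitaries_one_plus)"
  then show "continuous_on UNIV (\<lambda>g. U * star (mult_extend (\<beta> g) U))"
    by (intro coboundary_norm_continuous[OF assms]) auto
next
  fix u v :: "'g \<Rightarrow> 'b multiplier"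
  assume "is_action \<beta> \<and> \<not> has_unit TYPE('b)"
    and "is_cocycle \<beta> u \<and> strictly_continuous u \<and> is_cocycle \<beta> v \<and> strictly_continuous v \<and>
      (\<forall>g. u g - v g \<in> range mult_embed)"
  then show "continuous_on UNIV (\<lambda>g. u g - v g)"
    by (intro cocycle_diff_norm_continuous[OF assms]) auto
next
  fix \<phi>p up \<phi>m um
  assume "separable_space (euclidean :: 'a topology) \<and> separable_space (euclidean :: 'c topology) \<and>
      separable_infinite_dimensional TYPE('h) \<and>
      is_action \<alpha> \<and> is_action \<gamma> \<and> stabilization tensor \<and> stabilized_action tensor \<gamma> \<gamma>s"
  then have "is_action \<gamma>s" by (simp add: stabilized_action_def)
  then show "cuntz_pair \<alpha> \<gamma>s \<phi>p up \<phi>m um \<longleftrightarrow>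
      cocycle_representation \<alpha> \<gamma>s \<phi>p up \<and> cocycle_representation \<alpha> \<gamma>s \<phi>m um \<and>
      (\<forall>a. \<phi>p a - \<phi>m a \<in> range mult_embed) \<and>
      (\<forall>g. up g - um g \<in> range mult_embed)"
    using cocycle_diff_norm_continuous[OF assms, of \<gamma>s up um]
    by (auto simp: cuntz_pair_def cocycle_representation_def)
qed

end
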